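(* Let $\mathfrak g$ be a four dimensional Lie algebra admitting abelian complex structures, and let $J$ be a complex structure on $\mathfrak g$. Then $(\mathfrak g,J)$ is Kähler (i.e. there exists a symplectic structure on $\mathfrak g$ compatible with $J$) if and only if $\mathfrak g$ is symplectic and $J$ is abelian.
   Context: All Lie algebras are real. A complex structure on $\mathfrak g$ is an endomorphism $J$ with $J^2=-I$ and $[Jx,Jy]-[x,y]-J[Jx,y]-J[x,Jy]=0$ for all $x,y$; it is abelian if $[Jx,Jy]=[x,y]$ for all $x,y$. A symplectic structure is a closed nondegenerate 2-form $\omega$ on $\mathfrak g$ (closed: $\omega([x,y],z)+\omega([y,z],x)+\omega([z,x],y)=0$); $\mathfrak g$ is symplectic if it admits one. $\omega$ is compatible with $J$ if $\omega(Jx,Jy)=\omega(x,y)$ for all $x,y$. *)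

theory Defs
  imports "HOL-Analysis.Analysis"
begin

text \<open>The underlying vector space of a real Lie algebra is the whole of a type of class
  \<^class>\<open>real_vector\<close>; the Lie algebra is that space together with a bracket.\<close>

definition lie_bracket :: "('a::real_vector \<Rightarrow> 'a \<Rightarrow> 'a) \<Rightarrow> bool" where
  "lie_bracket br \<longleftrightarrow>
     bilinear br \<and>
     (\<forall>x. br x x = 0) \<and>
     (\<forall>x y z. br x (br y z) + br y (br z x) + br z (br x y) = 0)"

definition complex_structure ::
    "('a::real_vector \<Rightarrow> 'a \<Rightarrow> 'a) \<Rightarrow> ('a \<Rightarrow> 'a) \<Rightarrow> bool" where
  "complex_structure br J \<longleftrightarrow>
     linear J \<and>
     (\<forall>x. J (J x) = - x) \<and>
     (\<forall>x y. br (J x) (J y) - br x y - J (br (J x) y) - J (br x (J y)) = 0)"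

definition abelian_structure ::
    "('a::real_vector \<Rightarrow> 'a \<Rightarrow> 'a) \<Rightarrow> ('a \<Rightarrow> 'a) \<Rightarrow> bool" where
  "abelian_structure br J \<longleftrightarrow> (\<forall>x y. br (J x) (J y) = br x y)"

definition symplectic_structure ::
    "('a::real_vector \<Rightarrow> 'a \<Rightarrow> 'a) \<Rightarrow> ('a \<Rightarrow> 'a \<Rightarrow> real) \<Rightarrow> bool" where
  "symplectic_structure br \<omega> \<longleftrightarrow>
     bilinear \<omega> \<and>
     (\<forall>x. \<omega> x x = 0) \<and>
     (\<forall>x y z. \<omega> (br x y) z + \<omega> (br y z) x + \<omega> (br z x) y = 0) \<and>
     (\<forall>x. (\<forall>y. \<omega> x y = 0) \<longrightarrow> x = 0)"

definition symplectic :: "('a::real_vector \<Rightarrow> 'a \<Rightarrow> 'a) \<Rightarrow> bool" where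
  "symplectic br \<longleftrightarrow> (\<exists>\<omega>. symplectic_structure br \<omega>)"

definition compatible ::
    "('a::real_vector \<Rightarrow> 'a \<Rightarrow> real) \<Rightarrow> ('a \<Rightarrow> 'a) \<Rightarrow> bool" where
  "compatible \<omega> J \<longleftrightarrow> (\<forall>x y. \<omega> (J x) (J y) = \<omega> x y)"

text \<open>No positivity is imposed on the symmetric form \<open>\<omega> (J x) y\<close>: a Kaehler pair in this
  sense is what is elsewhere called pseudo-Kaehler.\<close>

definition kaehler :: "('a::real_vector \<Rightarrow> 'a \<Rightarrow> 'a) \<Rightarrow> ('a \<Rightarrow> 'a) \<Rightarrow> bool" where
  "kaehler br J \<longleftrightarrow> (\<exists>\<omega>. symplectic_structure br \<omega> \<and> compatible \<omega> J)"

end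

theory Submission
  imports Defs
begin

text \<open>Let \<open>V\<close> be the span of all brackets. The existence of an abelian complex structure \<open>J'\<close>
  restricts the Lie algebra; the given \<open>J\<close> is then studied on each algebra that remains.

  An abelian complex structure makes the algebra metabelian: in the complexification, the eigenspaces of \<open>J'\<close> are
  abelian subspaces whose sum is everything, so Ito's theorem applies (\<open>metabelian_if_abelian_structure\<close>).
  In dimension four this leaves two possibilities (\<open>derived_line_or_affine_frame\<close>). Either \<open>V\<close> is contained in
  a line, or \<open>V\<close> is an abelian plane on which some \<open>s\<close> acts as the identity and some \<open>t\<close> has a
  cyclic vector, so that the algebra is the affine algebra of a two-dimensional commutative algebra with unit.

  In each case \<open>J\<close> admits a compatible symplectic form if and only if it is abelian. If \<open>V\<close> lies in a line,
  every complex structure is abelian, by integrability alone, and a compatible form is written down in coordinates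
  adapted to \<open>J\<close> (\<open>kaehler_if_derived_line\<close>).

  If \<open>V\<close> is a plane and \<open>J\<close> is abelian, every exact form \<open>\<phi> [u, v]\<close> is closed and compatible, and the cyclic vector
  provides a linear form \<open>\<phi>\<close> for which it is nondegenerate (\<open>kaehler_if_affine\<close>). Conversely, let \<open>J\<close> have a compatible
  symplectic form. If \<open>V\<close> and \<open>J V\<close> meet only in zero, integrability makes \<open>J\<close> abelian. Otherwise \<open>J V = V\<close>, the
  plane \<open>V\<close> is isotropic because \<open>s\<close> acts on it as the identity, and closedness forces \<open>J s\<close> to act on \<open>V\<close> as \<open>- J\<close>, which is what
  abelian means there (\<open>abelian_structure_if_derived_complex_line\<close>).\<close>

section \<open>Four-element bases of a four-dimensional space\<close>

text \<open>Coefficient form of being a basis of four vectors. Independence and spanning are kept as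
  statements about four explicit scalars because every later argument compares coefficients.\<close>

definition frame :: "'a::real_vector \<Rightarrow> 'a \<Rightarrow> 'a \<Rightarrow> 'a \<Rightarrow> bool" where
  "frame a b c d \<longleftrightarrow>
     (\<forall>p q r s. p *\<^sub>R a + q *\<^sub>R b + r *\<^sub>R c + s *\<^sub>R d = 0 \<longrightarrow> p = 0 \<and> q = 0 \<and> r = 0 \<and> s = 0) \<and>
     (\<forall>v. \<exists>p q r s. v = p *\<^sub>R a + q *\<^sub>R b + r *\<^sub>R c + s *\<^sub>R d)"

lemma frameE:
  assumes "frame a b c d"
  obtains p q r s where "v = p *\<^sub>R a + q *\<^sub>R b + r *\<^sub>R c + s *\<^sub>R d"
  using assms unfolding frame_def by blast

lemma frame_coeff_zero:
  assumes "frame a b c d" "p *\<^sub>R a + q *\<^sub>R b + r *\<^sub>R c + s *\<^sub>R d = 0"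
  shows "p = 0" "q = 0" "r = 0" "s = 0"
  using assms unfolding frame_def by blast+

lemma span_pair_iff: "v \<in> span {x, y} \<longleftrightarrow> (\<exists>a b. v = a *\<^sub>R x + b *\<^sub>R y)"
  by (auto simp: span_breakdown_eq algebra_simps eq_diff_eq)

text \<open>A fifth vector outside the span would give five independent vectors inside the span of a
  four-element basis, contrary to the exchange lemma.\<close>

lemma frame_of_independent:
  fixes a b c d :: "'a::real_vector"
  assumes dim4: "dim (UNIV :: 'a set) = 4"
    and ind: "\<And>p q r s. p *\<^sub>R a + q *\<^sub>R b + r *\<^sub>R c + s *\<^sub>R d = 0 \<Longrightarrow>
                p = 0 \<and> q = 0 \<and> r = 0 \<and> s = 0"
  shows "frame a b c d"
proof -
  have a: "a \<notin> span {b, c, d}"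
  proof
    assume "a \<in> span {b, c, d}"
    then obtain k l m where "a - k *\<^sub>R b - l *\<^sub>R c - m *\<^sub>R d = 0"
      by (auto simp: span_breakdown_eq)
    with ind[of 1 "-k" "-l" "-m"] show False by (simp add: algebra_simps)
  qed
  have b: "b \<notin> span {c, d}"
  proof
    assume "b \<in> span {c, d}"
    then obtain l m where "b - l *\<^sub>R c - m *\<^sub>R d = 0"
      by (auto simp: span_breakdown_eq)
    with ind[of 0 1 "-l" "-m"] show False by (simp add: algebra_simps)
  qed
  have c: "c \<notin> span {d}"
  proof
    assume "c \<in> span {d}"
    then obtain m where "c - m *\<^sub>R d = 0"
      by (auto simp: span_breakdown_eq)
    with ind[of 0 0 1 "-m"] show False by (simp add: algebra_simps)
  qed
  have d: "d \<noteq> 0"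
    using ind[of 0 0 0 1] by auto
  have cd: "c \<noteq> d" using c span_superset[of "{d}"] by auto
  have bcd: "b \<notin> {c, d}" using b span_superset[of "{c, d}"] by auto
  have abcd: "a \<notin> {b, c, d}" using a span_superset[of "{b, c, d}"] by auto
  have indep: "independent {a, b, c, d}"
    using a b c d by (simp add: independent_insert)
  have card: "card {a, b, c, d} = 4"
    using cd bcd abcd by simp
  obtain B :: "'a set" where B: "UNIV \<subseteq> span B" "card B = 4"
    using basis_exists[of "UNIV :: 'a set"] dim4 by metis
  have finB: "finite B" using B(2) by (metis card.infinite zero_neq_numeral)
  have "v \<in> span {a, b, c, d}" for v
  proof (rule ccontr)
    assume v: "v \<notin> span {a, b, c, d}"
    hence vn: "v \<notin> {a, b, c, d}" using span_superset[of "{a, b, c, d}"] by auto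
    have "independent (insert v {a, b, c, d})"
      using indep v by (simp add: independent_insert)
    from independent_span_bound[OF finB this] B(1)
    have "card (insert v {a, b, c, d}) \<le> 4" using B(2) by auto
    moreover have "card (insert v {a, b, c, d}) = Suc 4"
      using vn card by (subst card_insert_disjoint) auto
    ultimately show False by simp
  qed
  hence "\<exists>p q r s. v = p *\<^sub>R a + q *\<^sub>R b + r *\<^sub>R c + s *\<^sub>R d" for v
    by (simp add: span_breakdown_eq) (metis add.assoc add.commute eq_iff_diff_eq_0 diff_diff_eq)
  with ind show ?thesis unfolding frame_def by blast
qed

lemma frame_coordinates:
  assumes F: "frame a b c d"
  obtains f g h k where "linear f" "linear g" "linear h" "linear k"
    "\<And>v. f v *\<^sub>R a + g v *\<^sub>R b + h v *\<^sub>R c + k v *\<^sub>R d = v"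
    "\<And>p q r s. f (p *\<^sub>R a + q *\<^sub>R b + r *\<^sub>R c + s *\<^sub>R d) = p"
    "\<And>p q r s. g (p *\<^sub>R a + q *\<^sub>R b + r *\<^sub>R c + s *\<^sub>R d) = q"
    "\<And>p q r s. h (p *\<^sub>R a + q *\<^sub>R b + r *\<^sub>R c + s *\<^sub>R d) = r"
    "\<And>p q r s. k (p *\<^sub>R a + q *\<^sub>R b + r *\<^sub>R c + s *\<^sub>R d) = s"
proof -
  have "\<forall>v. \<exists>w. v = fst w *\<^sub>R a + fst (snd w) *\<^sub>R b + fst (snd (snd w)) *\<^sub>R c + snd (snd (snd w)) *\<^sub>R d"
    using F unfolding frame_def by simp
  then obtain W where W: "\<And>v. v = fst (W v) *\<^sub>R a + fst (snd (W v)) *\<^sub>R b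
      + fst (snd (snd (W v))) *\<^sub>R c + snd (snd (snd (W v))) *\<^sub>R d"
    by metis
  define f g h k where
    "f v = fst (W v)" and "g v = fst (snd (W v))"
    and "h v = fst (snd (snd (W v)))" and "k v = snd (snd (snd (W v)))" for v
  have exp: "v = f v *\<^sub>R a + g v *\<^sub>R b + h v *\<^sub>R c + k v *\<^sub>R d" for v
    using W[of v] by (simp add: f_def g_def h_def k_def)
  have uniq: "f v = p \<and> g v = q \<and> h v = r \<and> k v = s"
    if "v = p *\<^sub>R a + q *\<^sub>R b + r *\<^sub>R c + s *\<^sub>R d" for v p q r s
  proof -
    have "(f v - p) *\<^sub>R a + (g v - q) *\<^sub>R b + (h v - r) *\<^sub>R c + (k v - s) *\<^sub>R d = 0"
      using exp[of v] that by (simp add: algebra_simps)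
    from frame_coeff_zero[OF F this] show ?thesis by simp
  qed
  have add: "f (u + v) = f u + f v \<and> g (u + v) = g u + g v \<and> h (u + v) = h u + h v \<and> k (u + v) = k u + k v" for u v
    by (rule uniq) (subst exp[of u], subst exp[of v], simp add: algebra_simps)
  have sc: "f (e *\<^sub>R v) = e * f v \<and> g (e *\<^sub>R v) = e * g v \<and> h (e *\<^sub>R v) = e * h v \<and> k (e *\<^sub>R v) = e * k v" for e v
    by (rule uniq) (subst exp[of v], simp add: algebra_simps)
  show thesis
    by (rule that[of f g h k]; (rule exp[symmetric] | rule linearI)?) (use add sc uniq in auto)
qed

section \<open>Real Lie algebras and sums of two abelian subspaces\<close>

locale lie_algebra =
  fixes br :: "'a::real_vector \<Rightarrow> 'a \<Rightarrow> 'a"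
  assumes lie: "lie_bracket br"
begin

lemma br_bilinear: "bilinear br"
  using lie by (simp add: lie_bracket_def)

lemmas br_simps =
  bilinear_ladd[OF br_bilinear] bilinear_radd[OF br_bilinear]
  bilinear_lmul[OF br_bilinear] bilinear_rmul[OF br_bilinear]
  bilinear_lneg[OF br_bilinear] bilinear_rneg[OF br_bilinear]
  bilinear_lsub[OF br_bilinear] bilinear_rsub[OF br_bilinear]
  bilinear_lzero[OF br_bilinear] bilinear_rzero[OF br_bilinear]

lemma br_self: "br x x = 0"
  using lie by (simp add: lie_bracket_def)

lemma jacobi: "br x (br y z) + br y (br z x) + br z (br x y) = 0"
  using lie by (simp add: lie_bracket_def)

lemma br_skew: "br y x = - br x y"
proof -
  have "br x y + br y x = br (x + y) (x + y) - br x x - br y y" by (simp add: br_simps)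
  hence "br x y + br y x = 0" by (simp only: br_self diff_zero)
  thus ?thesis by (simp add: add_eq_0_iff)
qed

lemma leibniz: "br x (br y z) = br (br x y) z + br y (br x z)"
  using jacobi[of x y z]
  by (simp add: br_skew[of "br x y" z] br_skew[of z x] br_simps add_eq_0_iff algebra_simps)

lemma br_commuting:
  assumes "br a b = 0" shows "br a (br b z) = br b (br a z)"
  using leibniz[of a b z] assms by (simp add: br_simps)

text \<open>The Lie algebra form of Ito's theorem on products of two abelian groups: a sum of two abelian
  subspaces is metabelian. Write \<open>[a, b'] = a\<^sub>1 + b\<^sub>1\<close> and \<open>[a', b] = a\<^sub>2 + b\<^sub>2\<close>. Since elements of \<open>A\<close>, and
  likewise elements of \<open>B\<close>, act by commuting operators, the two Leibniz terms of \<open>[[a, b], [a', b']]\<close> turn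
  into \<open>- [[a, b'], b\<^sub>2]\<close> and \<open>[a\<^sub>1, [a', b]]\<close>, which are \<open>- [a\<^sub>1, b\<^sub>2]\<close> and \<open>[a\<^sub>1, b\<^sub>2]\<close>.\<close>

lemma ito:
  assumes A: "\<And>a a'. a \<in> A \<Longrightarrow> a' \<in> A \<Longrightarrow> br a a' = 0"
    and B: "\<And>b b'. b \<in> B \<Longrightarrow> b' \<in> B \<Longrightarrow> br b b' = 0"
    and sum: "\<And>v. \<exists>a\<in>A. \<exists>b\<in>B. v = a + b"
  shows "br (br u v) (br z w) = 0"
proof -
  have mixed: "br (br a b) (br a' b') = 0"
    if "a \<in> A" "a' \<in> A" "b \<in> B" "b' \<in> B" for a b a' b'
  proof -
    obtain a1 b1 where 1: "a1 \<in> A" "b1 \<in> B" "br a b' = a1 + b1" using sum by blast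
    obtain a2 b2 where 2: "a2 \<in> A" "b2 \<in> B" "br a' b = a2 + b2" using sum by blast
    have "br a' (br a b) = br a (br a' b)"
      using br_commuting A that by blast
    also have "\<dots> = br a b2" using 2 A that by (simp add: br_simps)
    finally have I: "br (br a b) a' = - br a b2" using br_skew[of "br a b" a'] by simp
    have "br (br a b) b' = - br b' (br a b)" by (rule br_skew)
    also have "br b' (br a b) = - br b' (br b a)" using br_skew[of a b] by (simp add: br_simps)
    also have "br b' (br b a) = br b (br b' a)"
      using br_commuting B that by blast
    also have "\<dots> = - br b (br a b')" using br_skew[of b' a] by (simp add: br_simps)
    also have "br b (br a b') = br b a1" using 1 B that by (simp add: br_simps)
    finally have II: "br (br a b) b' = br a1 b" using br_skew[of b a1] by simp
    have ab2: "br (br a b2) b' = br (br a b') b2"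
    proof -
      have "br b2 (br b' a) = br b' (br b2 a)" using br_commuting B 2 that by blast
      thus ?thesis
        using br_skew[of "br a b2" b'] br_skew[of "br a b'" b2] br_skew[of a b2] br_skew[of a b']
        by (simp add: br_simps)
    qed
    have a1b: "br a' (br a1 b) = br a1 (br a' b)" using br_commuting A 1 that by blast
    have "br (br a b) (br a' b') = br (br (br a b) a') b' + br a' (br (br a b) b')"
      by (rule leibniz)
    also have "\<dots> = - br (br a b') b2 + br a1 (br a' b)"
      by (simp add: I II br_simps ab2 a1b)
    also have "\<dots> = 0"
      using A B 1 2 by (simp add: 1(3) 2(3) br_simps)
    finally show ?thesis .
  qed
  have split: "\<exists>a1\<in>A. \<exists>b1\<in>B. \<exists>a2\<in>A. \<exists>b2\<in>B. br u v = br a1 b2 - br a2 b1" for u v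
  proof -
    obtain a1 b1 where 1: "a1 \<in> A" "b1 \<in> B" "u = a1 + b1" using sum by blast
    obtain a2 b2 where 2: "a2 \<in> A" "b2 \<in> B" "v = a2 + b2" using sum by blast
    have "br u v = br a1 b2 - br a2 b1"
      using A B 1 2 br_skew[of b1 a2] by (simp add: 1(3) 2(3) br_simps)
    with 1 2 show ?thesis by blast
  qed
  obtain a1 b1 a2 b2 where 1: "a1 \<in> A" "b1 \<in> B" "a2 \<in> A" "b2 \<in> B" "br u v = br a1 b2 - br a2 b1"
    using split by metis
  obtain a3 b3 a4 b4 where 2: "a3 \<in> A" "b3 \<in> B" "a4 \<in> A" "b4 \<in> B" "br z w = br a3 b4 - br a4 b3"
    using split by metis
  show ?thesis using mixed 1 2 by (simp add: 1(5) 2(5) br_simps)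
qed

definition derived :: "'a set" where
  "derived = span {br u v | u v. True}"

lemma br_in_derived: "br u v \<in> derived"
  unfolding derived_def by (rule span_base) blast

lemma derived_subset: "subspace S \<Longrightarrow> (\<And>u v. br u v \<in> S) \<Longrightarrow> derived \<subseteq> S"
  unfolding derived_def by (rule span_minimal) auto

end

section \<open>Complexification and the real form of an abelian complex structure\<close>

text \<open>The bracket of the complexification, with \<open>(u, v)\<close> standing for \<open>u + i v\<close>. The complexification is
  used only as a real Lie algebra, so no complex scalars are introduced.\<close>

definition complexified_bracket ::
    "('a::real_vector \<Rightarrow> 'a \<Rightarrow> 'a) \<Rightarrow> 'a \<times> 'a \<Rightarrow> 'a \<times> 'a \<Rightarrow> 'a \<times> 'a" where
  "complexified_bracket br u v =
     (br (fst u) (fst v) - br (snd u) (snd v), br (fst u) (snd v) + br (snd u) (fst v))"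

lemma lie_bracket_complexified:
  assumes "lie_bracket br"
  shows "lie_bracket (complexified_bracket br)"
proof -
  interpret lie_algebra br by unfold_locales fact
  let ?C = "complexified_bracket br"
  have "bilinear ?C"
    unfolding bilinear_def complexified_bracket_def
    by (auto intro!: linearI simp: br_simps algebra_simps)
  moreover have "?C x x = 0" for x
    using br_skew[of "fst x" "snd x"]
    by (simp add: complexified_bracket_def br_self zero_prod_def)
  moreover have "?C x (?C y z) + ?C y (?C z x) + ?C z (?C x y) = 0" for x y z
  proof -
    obtain a a' b b' c c' where [simp]: "x = (a, a')" "y = (b, b')" "z = (c, c')"
      by (cases x, cases y, cases z) auto
    \<comment> \<open>real and imaginary part are signed sums of four real Jacobi identities each\<close>
    have "fst (?C x (?C y z) + ?C y (?C z x) + ?C z (?C x y)) =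
      (br a (br b c) + br b (br c a) + br c (br a b))
      - (br a (br b' c') + br b' (br c' a) + br c' (br a b'))
      - (br a' (br b c') + br b (br c' a') + br c' (br a' b))
      - (br a' (br b' c) + br b' (br c a') + br c (br a' b'))"
      by (simp add: complexified_bracket_def br_simps algebra_simps)
    moreover have "snd (?C x (?C y z) + ?C y (?C z x) + ?C z (?C x y)) =
      (br a' (br b c) + br b (br c a') + br c (br a' b))
      + (br a (br b' c) + br b' (br c a) + br c (br a b'))
      + (br a (br b c') + br b (br c' a) + br c' (br a b))
      - (br a' (br b' c') + br b' (br c' a') + br c' (br a' b'))"
      by (simp add: complexified_bracket_def br_simps algebra_simps)
    ultimately show ?thesis by (simp add: prod_eq_iff jacobi)
  qed
  ultimately show ?thesis unfolding lie_bracket_def by blast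
qed

locale almost_complex =
  fixes J :: "'a::real_vector \<Rightarrow> 'a"
  assumes J_linear: "linear J" and J_J: "J (J x) = - x"
begin

lemmas J_simps =
  linear_add[OF J_linear] linear_diff[OF J_linear] linear_neg[OF J_linear]
  linear_scale[OF J_linear] linear_0[OF J_linear] J_J

text \<open>Two vectors independent over the complex numbers, where \<open>J\<close> acts as \<open>i\<close>, give four vectors
  independent over the reals.\<close>

lemma frame_of_complex_line_and_outside:
  assumes dim4: "dim (UNIV :: 'a set) = 4" and "u \<noteq> 0" and w: "w \<notin> span {u, J u}"
  shows "frame u (J u) w (J w)"
proof (rule frame_of_independent[OF dim4])
  fix p q r s
  assume eq: "p *\<^sub>R u + q *\<^sub>R J u + r *\<^sub>R w + s *\<^sub>R J w = 0"
  have Jeq: "p *\<^sub>R J u - q *\<^sub>R u + r *\<^sub>R J w - s *\<^sub>R w = 0"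
    using arg_cong[OF eq, of J] by (simp add: J_simps)
  \<comment> \<open>multiplying the relation by \<open>r - i s\<close> clears the coefficient of \<open>J w\<close>\<close>
  have "(r * p + s * q) *\<^sub>R u + (r * q - s * p) *\<^sub>R J u + (r * r + s * s) *\<^sub>R w =
      r *\<^sub>R (p *\<^sub>R u + q *\<^sub>R J u + r *\<^sub>R w + s *\<^sub>R J w)
      - s *\<^sub>R (p *\<^sub>R J u - q *\<^sub>R u + r *\<^sub>R J w - s *\<^sub>R w)"
    by (simp add: algebra_simps)
  hence rel: "(r * p + s * q) *\<^sub>R u + (r * q - s * p) *\<^sub>R J u = - ((r * r + s * s) *\<^sub>R w)"
    by (simp add: eq Jeq eq_neg_iff_add_eq_0)
  have rs: "r = 0 \<and> s = 0"
  proof (rule ccontr)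
    assume "\<not> (r = 0 \<and> s = 0)"
    hence n: "r * r + s * s \<noteq> 0" by (simp add: sum_squares_eq_zero_iff)
    have "(r * r + s * s) *\<^sub>R w \<in> span {u, J u}"
      using span_neg[of "(r * p + s * q) *\<^sub>R u + (r * q - s * p) *\<^sub>R J u" "{u, J u}"]
      by (auto simp: rel span_pair_iff) (metis rel add.inverse_inverse)
    from span_scale[OF this, of "inverse (r * r + s * s)"] n w show False by simp
  qed
  with eq Jeq have 1: "p *\<^sub>R u + q *\<^sub>R J u = 0" and 2: "p *\<^sub>R J u - q *\<^sub>R u = 0" by simp_all
  have "(p * p + q * q) *\<^sub>R u = p *\<^sub>R (p *\<^sub>R u + q *\<^sub>R J u) - q *\<^sub>R (p *\<^sub>R J u - q *\<^sub>R u)"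
    by (simp add: algebra_simps)
  with 1 2 \<open>u \<noteq> 0\<close> have "p * p + q * q = 0" by simp
  with rs show "p = 0 \<and> q = 0 \<and> r = 0 \<and> s = 0" by (simp add: sum_squares_eq_zero_iff)
qed

end

locale lie_almost_complex = lie_algebra br + almost_complex J
  for br :: "'a::real_vector \<Rightarrow> 'a \<Rightarrow> 'a" and J :: "'a \<Rightarrow> 'a"
begin

lemma abelian_br_J_left:
  assumes "abelian_structure br J" shows "br (J x) y = - br x (J y)"
proof -
  have "br (J x) (J (J y)) = br x (J y)" using assms by (simp add: abelian_structure_def)
  thus ?thesis by (simp add: J_J br_simps minus_equation_iff)
qed

text \<open>In the complexification the eigenspaces of \<open>J\<close>, consisting of the vectors \<open>x - i J x\<close> and \<open>x + i J x\<close>,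
  are abelian subspaces exactly because \<open>J\<close> is abelian, and together they span. So Ito's theorem applies.\<close>

lemma metabelian_if_abelian_structure:
  assumes ab: "abelian_structure br J"
  shows "br (br x y) (br z w) = 0"
proof -
  interpret C: lie_algebra "complexified_bracket br"
    by unfold_locales (rule lie_bracket_complexified[OF lie])
  have JJ: "br (J x) (J y) = br x y" for x y using ab by (simp add: abelian_structure_def)
  note Jl = abelian_br_J_left[OF ab]
  have "complexified_bracket br (complexified_bracket br (x, 0) (y, 0))
      (complexified_bracket br (z, 0) (w, 0)) = 0"
  proof (rule C.ito[where A = "range (\<lambda>x. (x, - J x))" and B = "range (\<lambda>x. (x, J x))"])
    fix v :: "'a \<times> 'a"
    obtain p q where v: "v = (p, q)" by (cases v)
    let ?a = "(1/2) *\<^sub>R (p + J q)" and ?b = "(1/2) *\<^sub>R (p - J q)"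
    have half: "(1/2) *\<^sub>R x + (1/2) *\<^sub>R x = x" for x :: 'a
      by (simp flip: scaleR_left_distrib)
    have "v = (?a, - J ?a) + (?b, J ?b)"
      using half by (simp add: v J_simps algebra_simps)
    thus "\<exists>a\<in>range (\<lambda>x. (x, - J x)). \<exists>b\<in>range (\<lambda>x. (x, J x)). v = a + b" by blast
  qed (auto simp: complexified_bracket_def br_simps JJ Jl J_J zero_prod_def)
  thus ?thesis by (simp add: complexified_bracket_def br_simps zero_prod_def)
qed

end

section \<open>Integrability, compatibility and exact forms\<close>

text \<open>The operators of \<open>s\<close> and \<open>t\<close> on the plane spanned by \<open>x\<close> and \<open>y\<close> are the identity and some \<open>N\<close> with
  \<open>N x = y\<close>. So \<open>x\<close> is a cyclic vector, and the commutative algebra generated by \<open>N\<close> acts on this plane as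
  on itself: this is the affine Lie algebra of a two-dimensional unital commutative algebra. The values
  \<open>[t, y]\<close> and \<open>[s, t]\<close>, which depend on the algebra and on the choice of \<open>s\<close> and \<open>t\<close>, are left open.\<close>

definition affine_frame ::
    "('a::real_vector \<Rightarrow> 'a \<Rightarrow> 'a) \<Rightarrow> 'a \<Rightarrow> 'a \<Rightarrow> 'a \<Rightarrow> 'a \<Rightarrow> bool" where
  "affine_frame br s t x y \<longleftrightarrow>
     (\<forall>u v. br u v \<in> span {x, y}) \<and>
     br x y = 0 \<and> br s x = x \<and> br s y = y \<and> br t x = y \<and>
     (\<forall>a b. a *\<^sub>R x + b *\<^sub>R y = 0 \<longrightarrow> a = 0 \<and> b = 0)"

context lie_almost_complex
begin

lemma scaled_eq_J_scaled_imp_zero: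
  assumes "a *\<^sub>R z = b *\<^sub>R J z" shows "a *\<^sub>R z = 0"
proof -
  have J: "a *\<^sub>R J z = - (b *\<^sub>R z)" using arg_cong[OF assms, of J] by (simp add: J_simps)
  have "(a * a) *\<^sub>R z = b *\<^sub>R (a *\<^sub>R J z)"
    using arg_cong[OF assms, of "scaleR a"] by (simp add: mult.commute)
  hence "(a * a + b * b) *\<^sub>R z = 0" by (simp add: J scaleR_left_distrib)
  thus ?thesis by (auto simp: sum_squares_eq_zero_iff)
qed

text \<open>Every bracket is a real multiple of \<open>z\<close>, while integrability equates \<open>[J u, J v] - [u, v]\<close> with a
  multiple of \<open>J z\<close>; the lines of \<open>z\<close> and of \<open>J z\<close> meet only in zero.\<close>

lemma abelian_structure_if_derived_line:
  assumes cs: "complex_structure br J" and line: "\<And>u v. \<exists>c. br u v = c *\<^sub>R z"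
  shows "abelian_structure br J"
  unfolding abelian_structure_def
proof (intro allI)
  fix u v
  obtain c1 c2 c3 c4 where c: "br (J u) (J v) = c1 *\<^sub>R z" "br u v = c2 *\<^sub>R z"
    "br (J u) v = c3 *\<^sub>R z" "br u (J v) = c4 *\<^sub>R z"
    using line by metis
  have "br (J u) (J v) - br u v - J (br (J u) v) - J (br u (J v)) = 0"
    using cs by (simp add: complex_structure_def)
  hence "(c1 - c2) *\<^sub>R z = (c3 + c4) *\<^sub>R J z"
    by (simp add: c J_simps algebra_simps)
  from scaled_eq_J_scaled_imp_zero[OF this] show "br (J u) (J v) = br u v"
    by (simp add: c algebra_simps)
qed

lemma abelian_structure_on_frame:
  assumes F: "frame u (J u) w (J w)"
    and 1: "br (J u) (J w) = br u w" and 2: "br (J u) w = - br u (J w)"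
  shows "abelian_structure br J"
  unfolding abelian_structure_def
proof (intro allI)
  fix v v'
  obtain p q r s where v: "v = p *\<^sub>R u + q *\<^sub>R J u + r *\<^sub>R w + s *\<^sub>R J w"
    using frameE[OF F] by blast
  obtain p' q' r' s' where v': "v' = p' *\<^sub>R u + q' *\<^sub>R J u + r' *\<^sub>R w + s' *\<^sub>R J w"
    using frameE[OF F] by blast
  have swap: "br w u = - br u w" "br w (J u) = br u (J w)" "br (J w) u = - br u (J w)"
    "br (J w) (J u) = - br u w" "br (J u) u = - br u (J u)" "br (J w) w = - br w (J w)"
    using br_skew[of w u] br_skew[of w "J u"] br_skew[of "J w" u] br_skew[of "J w" "J u"]
      br_skew[of "J u" u] br_skew[of "J w" w] 1 2 by (simp_all add: br_skew[of u w])
  show "br (J v) (J v') = br v v'"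
    by (simp add: v v' J_simps br_simps br_self swap 1 2 algebra_simps)
qed

lemma integrability:
  assumes "complex_structure br J"
  shows "br (J u) (J v) = br u v + J (br (J u) v + br u (J v))"
proof -
  have "br (J u) (J v) - br u v - J (br (J u) v) - J (br u (J v)) = 0"
    using assms by (simp add: complex_structure_def)
  thus ?thesis by (simp add: J_simps algebra_simps)
qed

text \<open>If the derived plane \<open>V\<close> meets \<open>J V\<close> only in zero, integrability already makes \<open>J\<close> abelian: for \<open>x\<close> and \<open>y\<close> in the abelian
  plane \<open>V\<close> it equates \<open>[J x, J y]\<close>, an element of \<open>V\<close>, with an element of \<open>J V\<close>, so both sides vanish.\<close>

lemma abelian_structure_if_derived_totally_real:
  assumes dim4: "dim (UNIV :: 'a set) = 4" and cs: "complex_structure br J"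
    and der: "\<And>u v. br u v \<in> span {x, y}" and xy: "br x y = 0"
    and x0: "x \<noteq> 0" and y: "y \<notin> span {x, J x}"
  shows "abelian_structure br J"
proof -
  have F: "frame x (J x) y (J y)" by (rule frame_of_complex_line_and_outside[OF dim4 x0 y])
  obtain a b where ab: "br (J x) (J y) = a *\<^sub>R x + b *\<^sub>R y"
    using der by (metis span_pair_iff)
  have "br (J x) y + br x (J y) \<in> span {x, y}" by (intro span_add der)
  then obtain c d where cd: "br (J x) y + br x (J y) = c *\<^sub>R x + d *\<^sub>R y"
    by (auto simp: span_pair_iff)
  have "a *\<^sub>R x + b *\<^sub>R y = J (c *\<^sub>R x + d *\<^sub>R y)"
    using integrability[OF cs, of x y] by (simp add: ab cd xy)
  hence "a *\<^sub>R x + (- c) *\<^sub>R J x + b *\<^sub>R y + (- d) *\<^sub>R J y = 0"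
    by (simp add: J_simps algebra_simps)
  note zero = frame_coeff_zero[OF F this]
  show ?thesis
  proof (rule abelian_structure_on_frame[OF F])
    show "br (J x) (J y) = br x y" using zero by (simp add: ab xy)
    show "br (J x) y = - br x (J y)" using zero cd by (simp add: add_eq_0_iff minus_equation_iff)
  qed
qed

text \<open>This is the one place where the compatible form is needed: on the affine algebra of the complex
  numbers there are complex structures that preserve the derived plane and are not abelian. Integrability makes
  the operator \<open>N\<close> of \<open>J s\<close> on the plane commute with \<open>J\<close>, and \<open>J\<close> is abelian as soon as \<open>N = - J\<close>. The plane is
  isotropic because \<open>s\<close> acts on it as the identity. Closedness on \<open>v, s, J s\<close> together with compatibility
  makes \<open>\<omega> ((N + J) v) s\<close> vanish for \<open>v\<close> in the plane. Taking \<open>v = x\<close> and \<open>v = J x\<close> shows that \<open>(N + J) x\<close> is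
  orthogonal to the whole algebra, so it is zero.\<close>

lemma abelian_structure_if_derived_complex_line:
  assumes dim4: "dim (UNIV :: 'a set) = 4" and cs: "complex_structure br J"
    and der: "\<And>u v. br u v \<in> span {x, J x}" and x0: "x \<noteq> 0" and xJx: "br x (J x) = 0"
    and sx: "br s x = x" and sJx: "br s (J x) = J x"
    and om: "symplectic_structure br \<omega>" and comp: "compatible \<omega> J"
  shows "abelian_structure br J"
proof -
  have bil: "bilinear \<omega>" and om_self: "\<And>u. \<omega> u u = 0"
    and closed: "\<And>u v w. \<omega> (br u v) w + \<omega> (br v w) u + \<omega> (br w u) v = 0"
    and nondeg: "\<And>u. (\<And>v. \<omega> u v = 0) \<Longrightarrow> u = 0"
    using om unfolding symplectic_structure_def by blast+
  note om_simps = bilinear_ladd[OF bil] bilinear_radd[OF bil] bilinear_lmul[OF bil]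
    bilinear_rmul[OF bil] bilinear_lneg[OF bil] bilinear_rneg[OF bil]
  have om_J: "\<omega> (J u) (J v) = \<omega> u v" for u v using comp by (simp add: compatible_def)
  have om_skew: "\<omega> v u = - \<omega> u v" for u v
  proof -
    have "\<omega> u v + \<omega> v u = \<omega> (u + v) (u + v) - \<omega> u u - \<omega> v v" by (simp add: om_simps)
    thus ?thesis by (simp only: om_self diff_zero add_eq_0_iff)
  qed
  have "s \<notin> span {x, J x}"
  proof
    assume "s \<in> span {x, J x}"
    then obtain c d where "s = c *\<^sub>R x + d *\<^sub>R J x" by (auto simp: span_pair_iff)
    hence "br s x = 0" using br_skew[of "J x" x] by (simp add: br_simps br_self xJx)
    with sx x0 show False by simp
  qed
  hence F: "frame x (J x) s (J s)" by (rule frame_of_complex_line_and_outside[OF dim4 x0])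
  have iso: "\<omega> x (J x) = 0"
    using closed[of x "J x" s] br_skew[of "J x" s] om_skew[of x "J x"]
    by (simp add: xJx sx sJx om_simps bilinear_lzero[OF bil])
  have iso': "\<omega> u x = 0" "\<omega> u (J x) = 0" if "u \<in> span {x, J x}" for u
    using that iso om_skew[of x "J x"] by (auto simp: span_pair_iff om_simps om_self)
  have NJ: "br (J s) (J x) = J (br (J s) x)"
    using integrability[OF cs, of s x] by (simp add: sx sJx J_simps)
  \<comment> \<open>the defect \<open>(N + J) x\<close>; it lies in the isotropic plane, so only \<open>s\<close> and \<open>J s\<close> remain to be tested\<close>
  define e where "e = br (J s) x + J x"
  have Je: "J e = br (J s) (J x) - x" by (simp add: e_def NJ J_simps)
  have "J x \<in> span {x, J x}" by (simp add: span_base)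
  hence e_in: "e \<in> span {x, J x}" unfolding e_def by (intro span_add der)
  have es: "\<omega> e s = 0"
    using closed[of x s "J s"] br_skew[of x s] iso'(1)[OF der[of s "J s"]] om_J[of x "J s"]
    by (simp add: sx e_def om_simps J_J)
  have Jes: "\<omega> (J e) s = 0"
    using closed[of "J x" s "J s"] br_skew[of "J x" s] iso'(2)[OF der[of s "J s"]] om_J[of x s]
    by (simp add: sJx Je om_simps bilinear_lsub[OF bil])
  have eJs: "\<omega> e (J s) = 0"
    using Jes om_J[of e "J s"] by (simp add: J_J om_simps)
  have "e = 0"
  proof (rule nondeg)
    fix v
    obtain p q r t where "v = p *\<^sub>R x + q *\<^sub>R J x + r *\<^sub>R s + t *\<^sub>R J s"
      using frameE[OF F] by blast
    thus "\<omega> e v = 0" using iso'[OF e_in] by (simp add: om_simps es eJs)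
  qed
  hence Nx: "br (J s) x = - J x" by (simp add: e_def add_eq_0_iff minus_equation_iff)
  show ?thesis
  proof (rule abelian_structure_on_frame[OF F])
    show "br (J x) (J s) = br x s"
      using NJ br_skew[of "J x" "J s"] br_skew[of x s] by (simp add: Nx sx J_simps)
    show "br (J x) s = - br x (J s)"
      using br_skew[of "J x" s] br_skew[of x "J s"] by (simp add: Nx sJx)
  qed
qed

lemma abelian_structure_if_kaehler_affine:
  assumes dim4: "dim (UNIV :: 'a set) = 4" and cs: "complex_structure br J"
    and A: "affine_frame br s t x y" and K: "kaehler br J"
  shows "abelian_structure br J"
proof -
  have der: "\<And>u v. br u v \<in> span {x, y}" and xy: "br x y = 0" and sx: "br s x = x"
    and sy: "br s y = y"
    and ind: "\<And>a b. a *\<^sub>R x + b *\<^sub>R y = 0 \<Longrightarrow> a = 0 \<and> b = 0"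
    using A unfolding affine_frame_def by blast+
  have x0: "x \<noteq> 0" using ind[of 1 0] by auto
  show ?thesis
  proof (cases "y \<in> span {x, J x}")
    case False
    show ?thesis by (rule abelian_structure_if_derived_totally_real[OF dim4 cs der xy x0 False])
  next
    case True
    then obtain a b where y: "y = a *\<^sub>R x + b *\<^sub>R J x" by (auto simp: span_pair_iff)
    have b0: "b \<noteq> 0" using ind[of "-a" 1] y by auto
    have Jx: "J x = inverse b *\<^sub>R y + (- a / b) *\<^sub>R x"
      using b0 by (simp add: y algebra_simps divide_inverse)
    have "{x, y} \<subseteq> span {x, J x}" using True by (simp add: span_base)
    hence der': "br u v \<in> span {x, J x}" for u v
      using der span_minimal[OF _ subspace_span] by blast
    have 1: "br x (J x) = 0" by (subst Jx) (simp add: br_simps br_self xy)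
    have 2: "br s (J x) = J x" by (subst (1 2) Jx) (simp add: br_simps sx sy)
    from K obtain \<omega> where "symplectic_structure br \<omega>" "compatible \<omega> J"
      unfolding kaehler_def by blast
    with abelian_structure_if_derived_complex_line[OF dim4 cs der' x0 1 sx 2] show ?thesis .
  qed
qed

text \<open>For any linear form \<open>\<phi>\<close> the form \<open>\<phi> [u, v]\<close> is closed by the Jacobi identity and compatible with an
  abelian \<open>J\<close>. With \<open>\<phi> x = 0\<close> and \<open>\<phi> y = 1\<close> the pairing of \<open>s, t\<close> with \<open>x, y\<close> has the matrix \<open>0, 1; 1, *\<close>, which is
  invertible, and the plane of \<open>x\<close> and \<open>y\<close> is isotropic; hence the form is nondegenerate.\<close>

lemma kaehler_if_affine:
  assumes dim4: "dim (UNIV :: 'a set) = 4" and ab: "abelian_structure br J"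
    and A: "affine_frame br s t x y"
  shows "kaehler br J"
proof -
  have der: "\<And>u v. br u v \<in> span {x, y}" and xy: "br x y = 0" and sx: "br s x = x"
    and sy: "br s y = y" and tx: "br t x = y"
    and ind: "\<And>a b. a *\<^sub>R x + b *\<^sub>R y = 0 \<Longrightarrow> a = 0 \<and> b = 0"
    using A unfolding affine_frame_def by blast+
  have yx: "br y x = 0" using br_skew[of y x] xy by simp
  have F: "frame x y s t"
  proof (rule frame_of_independent[OF dim4])
    fix p q r k
    assume eq: "p *\<^sub>R x + q *\<^sub>R y + r *\<^sub>R s + k *\<^sub>R t = 0"
    have "br (p *\<^sub>R x + q *\<^sub>R y + r *\<^sub>R s + k *\<^sub>R t) x = 0"
      unfolding eq by (simp add: br_simps)
    hence "r *\<^sub>R x + k *\<^sub>R y = 0"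
      by (simp add: br_simps br_self sx tx yx)
    from ind[OF this] have "r = 0" "k = 0" by auto
    with eq ind[of p q] show "p = 0 \<and> q = 0 \<and> r = 0 \<and> k = 0" by simp
  qed
  obtain f \<phi> h k where lin: "linear \<phi>"
    and phi: "\<And>p q r l. \<phi> (p *\<^sub>R x + q *\<^sub>R y + r *\<^sub>R s + l *\<^sub>R t) = q"
    by (rule frame_coordinates[OF F]) blast
  have phi_x: "\<phi> x = 0" and phi_y: "\<phi> y = 1"
    using phi[of 1 0 0 0] phi[of 0 1 0 0] by simp_all
  define \<omega> where "\<omega> u v = \<phi> (br u v)" for u v
  have "bilinear \<omega>"
    unfolding bilinear_def \<omega>_def
    by (auto intro!: linearI simp: br_simps linear_add[OF lin] linear_scale[OF lin])
  moreover have "\<omega> u u = 0" for u by (simp add: \<omega>_def br_self linear_0[OF lin])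
  moreover have "\<omega> (br u v) w + \<omega> (br v w) u + \<omega> (br w u) v = 0" for u v w
  proof -
    have "br (br u v) w + br (br v w) u + br (br w u) v = 0"
      using jacobi[of u v w] br_skew[of w "br u v"] br_skew[of u "br v w"] br_skew[of v "br w u"]
      by (simp add: add_eq_0_iff algebra_simps)
    thus ?thesis
      by (simp add: \<omega>_def flip: linear_add[OF lin]) (simp add: linear_0[OF lin])
  qed
  moreover have "u = 0" if u0: "\<forall>v. \<omega> u v = 0" for u
  proof -
    note om_simps = br_simps br_self sx sy tx xy yx phi_x phi_y
      linear_add[OF lin] linear_scale[OF lin] linear_neg[OF lin] linear_diff[OF lin] linear_0[OF lin]
    obtain p q r l where u: "u = p *\<^sub>R x + q *\<^sub>R y + r *\<^sub>R s + l *\<^sub>R t"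
      using frameE[OF F] by blast
    have "\<omega> u x = l" by (simp add: \<omega>_def u om_simps)
    hence l: "l = 0" using u0 by simp
    have "\<omega> u y = r" by (simp add: \<omega>_def u l om_simps)
    hence r: "r = 0" using u0 by simp
    have "\<omega> u s = - q"
      using br_skew[of x s] br_skew[of y s] by (simp add: \<omega>_def u l r om_simps)
    hence q: "q = 0" using u0 by simp
    have "\<omega> u t = - p" using br_skew[of x t] by (simp add: \<omega>_def u l r q om_simps)
    hence p: "p = 0" using u0 by simp
    show "u = 0" by (simp add: u p q r l)
  qed
  ultimately have "symplectic_structure br \<omega>" unfolding symplectic_structure_def by blast
  moreover have "compatible \<omega> J"
    using ab by (simp add: compatible_def \<omega>_def abelian_structure_def)
  ultimately show ?thesis unfolding kaehler_def by blast
qed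

end

section \<open>Compatible symplectic forms when the derived algebra is a line\<close>

lemma exists_outside_span_pair:
  fixes x y :: "'a::real_vector"
  assumes dim4: "dim (UNIV :: 'a set) = 4"
  obtains w :: 'a where "w \<notin> span {x, y}"
proof -
  have "\<exists>w. w \<notin> span {x, y}"
  proof (rule ccontr)
    assume "\<not> ?thesis"
    hence "(UNIV :: 'a set) \<subseteq> span {x, y}" by blast
    hence "dim (UNIV :: 'a set) \<le> card {x, y}" by (rule dim_le_card) simp
    also have "\<dots> \<le> 2" using card_insert_le_m1[of 2 "{y}" x] by simp
    finally show False using dim4 by simp
  qed
  with that show thesis by blast
qed

context lie_almost_complex
begin

text \<open>In these coordinates \<open>f + i g\<close> and \<open>h + i k\<close> are complex linear for \<open>J\<close>, so compatible forms can be
  read off.\<close>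

lemma J_coordinates:
  assumes F: "frame z (J z) w (J w)"
  obtains f g h k where "linear f" "linear g" "linear h" "linear k"
    "\<And>v. f v *\<^sub>R z + g v *\<^sub>R J z + h v *\<^sub>R w + k v *\<^sub>R J w = v"
    "\<And>v. f (J v) = - g v" "\<And>v. g (J v) = f v" "\<And>v. h (J v) = - k v" "\<And>v. k (J v) = h v"
    "f z = 1" "g z = 0" "h z = 0" "k z = 0" "f w = 0" "g w = 0" "h w = 1" "k w = 0"
proof -
  obtain f g h k where lin: "linear f" "linear g" "linear h" "linear k"
    and exp: "\<And>v. f v *\<^sub>R z + g v *\<^sub>R J z + h v *\<^sub>R w + k v *\<^sub>R J w = v"
    and co: "\<And>p q r s. f (p *\<^sub>R z + q *\<^sub>R J z + r *\<^sub>R w + s *\<^sub>R J w) = p"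
    "\<And>p q r s. g (p *\<^sub>R z + q *\<^sub>R J z + r *\<^sub>R w + s *\<^sub>R J w) = q"
    "\<And>p q r s. h (p *\<^sub>R z + q *\<^sub>R J z + r *\<^sub>R w + s *\<^sub>R J w) = r"
    "\<And>p q r s. k (p *\<^sub>R z + q *\<^sub>R J z + r *\<^sub>R w + s *\<^sub>R J w) = s"
  proof (rule frame_coordinates[OF F], goal_cases)
    case 1 show thesis by (rule 1(1)[OF 1(2-)])
  qed
  have Jv: "J v = (- g v) *\<^sub>R z + f v *\<^sub>R J z + (- k v) *\<^sub>R w + h v *\<^sub>R J w" for v
    using arg_cong[OF exp[of v, symmetric], of J] by (simp add: J_simps algebra_simps)
  show thesis
  proof (rule that[OF lin exp])
    show "f (J v) = - g v" "g (J v) = f v" "h (J v) = - k v" "k (J v) = h v" for v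
      by (subst Jv, rule co)+
    show "f z = 1" "g z = 0" "h z = 0" "k z = 0"
      using co[of 1 0 0 0] by simp_all
    show "f w = 0" "g w = 0" "h w = 1" "k w = 0"
      using co[of 0 0 1 0] by simp_all
  qed
qed

text \<open>For nonzero \<open>\<kappa>\<close> the algebra is the Heisenberg algebra plus a line, for \<open>\<kappa> = 0\<close> it is abelian. The bracket
  is \<open>\<kappa> (h \<and> k) z\<close>, so a form \<open>\<omega>\<close> is closed when \<open>\<omega> z\<close> is a combination of \<open>h\<close> and \<open>k\<close>. The form
  \<open>f \<and> h + g \<and> k\<close> meets this condition, as contracting it with \<open>z\<close> gives \<open>h\<close>.\<close>

lemma kaehler_if_heisenberg_frame:
  assumes F: "frame z (J z) w (J w)"
    and z: "br z w = 0" "br z (J w) = 0" "br (J z) w = 0" "br (J z) (J w) = 0" "br z (J z) = 0"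
    and w: "br w (J w) = \<kappa> *\<^sub>R z"
  shows "kaehler br J"
proof -
  obtain f g h k where lin: "linear f" "linear g" "linear h" "linear k"
    and exp: "\<And>v. f v *\<^sub>R z + g v *\<^sub>R J z + h v *\<^sub>R w + k v *\<^sub>R J w = v"
    and J: "\<And>v. f (J v) = - g v" "\<And>v. g (J v) = f v" "\<And>v. h (J v) = - k v" "\<And>v. k (J v) = h v"
    and vals: "f z = 1" "g z = 0" "h z = 0" "k z = 0" "f w = 0" "g w = 0" "h w = 1" "k w = 0"
  proof (rule J_coordinates[OF F], goal_cases)
    case 1 show thesis by (rule 1(1)[OF 1(2-)])
  qed
  note lin_simps = linear_add[OF lin(1)] linear_add[OF lin(2)] linear_add[OF lin(3)]
    linear_add[OF lin(4)] linear_scale[OF lin(1)] linear_scale[OF lin(2)]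
    linear_scale[OF lin(3)] linear_scale[OF lin(4)]
  have swap: "br w z = 0" "br (J w) z = 0" "br w (J z) = 0" "br (J w) (J z) = 0"
    "br (J z) z = - br z (J z)" "br (J w) w = - br w (J w)"
    by (simp_all add: z br_skew[of w z] br_skew[of "J w" z] br_skew[of w "J z"]
        br_skew[of "J w" "J z"] br_skew[of "J z" z] br_skew[of "J w" w])
  have br: "br u v = (\<kappa> * (h u * k v - k u * h v)) *\<^sub>R z" for u v
  proof -
    have "br u v = br (f u *\<^sub>R z + g u *\<^sub>R J z + h u *\<^sub>R w + k u *\<^sub>R J w)
        (f v *\<^sub>R z + g v *\<^sub>R J z + h v *\<^sub>R w + k v *\<^sub>R J w)"
      by (rule arg_cong2[OF exp[symmetric] exp[symmetric]])
    also have "\<dots> = (\<kappa> * (h u * k v - k u * h v)) *\<^sub>R z"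
      by (simp add: br_simps br_self swap z w algebra_simps)
    finally show ?thesis .
  qed
  define \<omega> where "\<omega> u v = f u * h v - h u * f v + g u * k v - k u * g v" for u v
  have "bilinear \<omega>"
    unfolding bilinear_def \<omega>_def by (auto intro!: linearI simp: lin_simps algebra_simps)
  moreover have "\<omega> u u = 0" for u by (simp add: \<omega>_def)
  moreover have "\<omega> (br u v) y + \<omega> (br v y) u + \<omega> (br y u) v = 0" for u v y
    by (simp add: \<omega>_def br lin_simps vals) (simp add: algebra_simps)
  moreover have "u = 0" if u: "\<forall>v. \<omega> u v = 0" for u
  proof -
    have "h u = 0" using u[rule_format, of z] by (simp add: \<omega>_def vals)
    moreover have "k u = 0" using u[rule_format, of "J z"] by (simp add: \<omega>_def J vals)
    moreover have "f u = 0" using u[rule_format, of w] by (simp add: \<omega>_def vals)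
    moreover have "g u = 0" using u[rule_format, of "J w"] by (simp add: \<omega>_def J vals)
    ultimately show "u = 0" using exp[of u] by simp
  qed
  ultimately have "symplectic_structure br \<omega>" unfolding symplectic_structure_def by blast
  moreover have "compatible \<omega> J"
    by (simp add: compatible_def \<omega>_def J algebra_simps)
  ultimately show ?thesis unfolding kaehler_def by blast
qed

text \<open>For nonzero \<open>\<kappa>\<close> the algebra is the affine algebra of the line plus an abelian plane. The bracket is
  \<open>\<kappa> (f \<and> g) z\<close>, and contracting \<open>f \<and> g + h \<and> k\<close> with \<open>z\<close> gives \<open>g\<close>, which is annihilated by wedging with \<open>f \<and> g\<close>.\<close>

lemma kaehler_if_aff_line_frame:
  assumes F: "frame z (J z) w (J w)"
    and w: "br z w = 0" "br z (J w) = 0" "br (J z) w = 0" "br (J z) (J w) = 0" "br w (J w) = 0"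
    and z: "br z (J z) = \<kappa> *\<^sub>R z"
  shows "kaehler br J"
proof -
  obtain f g h k where lin: "linear f" "linear g" "linear h" "linear k"
    and exp: "\<And>v. f v *\<^sub>R z + g v *\<^sub>R J z + h v *\<^sub>R w + k v *\<^sub>R J w = v"
    and J: "\<And>v. f (J v) = - g v" "\<And>v. g (J v) = f v" "\<And>v. h (J v) = - k v" "\<And>v. k (J v) = h v"
    and vals: "f z = 1" "g z = 0" "h z = 0" "k z = 0" "f w = 0" "g w = 0" "h w = 1" "k w = 0"
  proof (rule J_coordinates[OF F], goal_cases)
    case 1 show thesis by (rule 1(1)[OF 1(2-)])
  qed
  note lin_simps = linear_add[OF lin(1)] linear_add[OF lin(2)] linear_add[OF lin(3)]
    linear_add[OF lin(4)] linear_scale[OF lin(1)] linear_scale[OF lin(2)]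
    linear_scale[OF lin(3)] linear_scale[OF lin(4)]
  have swap: "br w z = 0" "br (J w) z = 0" "br w (J z) = 0" "br (J w) (J z) = 0"
    "br (J z) z = - br z (J z)" "br (J w) w = - br w (J w)"
    by (simp_all add: w br_skew[of w z] br_skew[of "J w" z] br_skew[of w "J z"]
        br_skew[of "J w" "J z"] br_skew[of "J z" z] br_skew[of "J w" w])
  have br: "br u v = (\<kappa> * (f u * g v - g u * f v)) *\<^sub>R z" for u v
  proof -
    have "br u v = br (f u *\<^sub>R z + g u *\<^sub>R J z + h u *\<^sub>R w + k u *\<^sub>R J w)
        (f v *\<^sub>R z + g v *\<^sub>R J z + h v *\<^sub>R w + k v *\<^sub>R J w)"
      by (rule arg_cong2[OF exp[symmetric] exp[symmetric]])
    also have "\<dots> = (\<kappa> * (f u * g v - g u * f v)) *\<^sub>R z"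
      by (simp add: br_simps br_self swap z w algebra_simps)
    finally show ?thesis .
  qed
  define \<omega> where "\<omega> u v = f u * g v - g u * f v + h u * k v - k u * h v" for u v
  have "bilinear \<omega>"
    unfolding bilinear_def \<omega>_def by (auto intro!: linearI simp: lin_simps algebra_simps)
  moreover have "\<omega> u u = 0" for u by (simp add: \<omega>_def)
  moreover have "\<omega> (br u v) y + \<omega> (br v y) u + \<omega> (br y u) v = 0" for u v y
    by (simp add: \<omega>_def br lin_simps vals) (simp add: algebra_simps)
  moreover have "u = 0" if u: "\<forall>v. \<omega> u v = 0" for u
  proof -
    have "g u = 0" using u[rule_format, of z] by (simp add: \<omega>_def vals)
    moreover have "f u = 0" using u[rule_format, of "J z"] by (simp add: \<omega>_def J vals)
    moreover have "k u = 0" using u[rule_format, of w] by (simp add: \<omega>_def vals)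
    moreover have "h u = 0" using u[rule_format, of "J w"] by (simp add: \<omega>_def J vals)
    ultimately show "u = 0" using exp[of u] by simp
  qed
  ultimately have "symplectic_structure br \<omega>" unfolding symplectic_structure_def by blast
  moreover have "compatible \<omega> J"
    by (simp add: compatible_def \<omega>_def J algebra_simps)
  ultimately show ?thesis unfolding kaehler_def by blast
qed

text \<open>The bracket is a two-form times \<open>z\<close>, and \<open>l\<close> decides whether \<open>z\<close> lies in the radical of that form.
  If \<open>l = 0\<close>, the Jacobi identity gives \<open>(a\<^sup>2 + b\<^sup>2) z = 0\<close>, so \<open>z\<close> and \<open>J z\<close> are central. If \<open>l\<close> is nonzero, subtracting
  suitable multiples of \<open>z\<close> and \<open>J z\<close> moves \<open>e\<close> to a vector \<open>w\<close> commuting with both, and the Jacobi identity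
  then kills \<open>[w, J w]\<close>.\<close>

lemma kaehler_if_derived_line:
  assumes dim4: "dim (UNIV :: 'a set) = 4" and ab: "abelian_structure br J"
    and line: "\<And>u v. \<exists>c. br u v = c *\<^sub>R z" and z0: "z \<noteq> 0"
  shows "kaehler br J"
proof -
  have JJ: "br (J u) (J v) = br u v" for u v using ab by (simp add: abelian_structure_def)
  note Jl = abelian_br_J_left[OF ab]
  obtain e where e: "e \<notin> span {z, J z}" by (rule exists_outside_span_pair[OF dim4])
  obtain l a b c where l: "br (J z) z = l *\<^sub>R z" and a: "br e z = a *\<^sub>R z"
    and b: "br e (J z) = b *\<^sub>R z" and c: "br e (J e) = c *\<^sub>R z"
    using line by metis
  show ?thesis
  proof (cases "l = 0")
    case True
    have Fe: "frame z (J z) e (J e)" by (rule frame_of_complex_line_and_outside[OF dim4 z0 e])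
    have zJz: "br z (J z) = 0" using l True br_skew[of z "J z"] by simp
    have Je: "br (J e) z = - (b *\<^sub>R z)" "br (J e) (J z) = a *\<^sub>R z"
      using Jl[of e z] by (simp_all add: JJ a b)
    have "br e (br (J e) (J z)) = br (br e (J e)) (J z) + br (J e) (br e (J z))"
      by (rule leibniz)
    hence "(a * a) *\<^sub>R z = - ((b * b) *\<^sub>R z)"
      by (simp add: Je a b c zJz br_simps)
    hence "(a * a + b * b) *\<^sub>R z = 0"
      by (simp add: scaleR_left_distrib)
    hence "a = 0" "b = 0" using z0 by (auto simp: sum_squares_eq_zero_iff)
    hence 0: "br z e = 0" "br (J z) e = 0"
      using a b br_skew[of z e] br_skew[of "J z" e] by auto
    show ?thesis
    proof (rule kaehler_if_heisenberg_frame[OF Fe _ _ _ _ _ c])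
      show "br z (J e) = 0" using 0 Jl[of z e] by simp
      show "br z (J z) = 0" by (rule zJz)
    qed (use 0 JJ in simp_all)
  next
    case False
    define w where "w = e + (b / l) *\<^sub>R z - (a / l) *\<^sub>R J z"
    have w_out: "w \<notin> span {z, J z}"
    proof
      assume "w \<in> span {z, J z}"
      moreover have "e = w - (b / l) *\<^sub>R z + (a / l) *\<^sub>R J z" by (simp add: w_def)
      ultimately have "e \<in> span {z, J z}"
        by (simp add: span_add span_diff span_scale span_base)
      with e show False ..
    qed
    have F: "frame z (J z) w (J w)" by (rule frame_of_complex_line_and_outside[OF dim4 z0 w_out])
    have wz: "br w z = 0" using False by (simp add: w_def br_simps br_self l a)
    have wJz: "br w (J z) = 0"
      using False br_skew[of z "J z"] by (simp add: w_def br_simps br_self l b)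
    have Jwz: "br (J w) z = 0" using wJz Jl[of w z] by simp
    have 0: "br z w = 0" "br (J z) w = 0" "br z (J w) = 0"
      using wz wJz Jwz br_skew[of z w] br_skew[of "J z" w] br_skew[of z "J w"] by auto
    obtain d where d: "br w (J w) = d *\<^sub>R z" using line by metis
    have "br w (br (J w) (J z)) = br (br w (J w)) (J z) + br (J w) (br w (J z))" by (rule leibniz)
    hence "(d * l) *\<^sub>R z = 0"
      using br_skew[of z "J z"] by (simp add: JJ wz wJz d l br_simps)
    hence "d = 0" using False z0 by simp
    hence ww: "br w (J w) = 0" using d by simp
    have zz: "br z (J z) = (- l) *\<^sub>R z" using l br_skew[of z "J z"] by simp
    show ?thesis
      by (rule kaehler_if_aff_line_frame[OF F _ _ _ _ ww zz]) (use 0 JJ in simp_all)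
  qed
qed

end

section \<open>Classification of the algebras with an abelian complex structure\<close>

lemma proportional_pairs:
  fixes p1 p2 s1 s2 q1 q2 :: real
  assumes "p1 * s2 = p2 * s1" "s1 * q2 = s2 * q1" "p1 * q2 = p2 * q1"
  obtains z1 z2 a b c where "p1 = a * z1" "p2 = a * z2" "s1 = b * z1" "s2 = b * z2"
    "q1 = c * z1" "q2 = c * z2"
proof -
  have key: "\<exists>b. y1 = b * x1 \<and> y2 = b * x2"
    if "x1 * y2 = x2 * y1" "x1 \<noteq> 0 \<or> x2 \<noteq> 0" for x1 x2 y1 y2 :: real
  proof (cases "x1 = 0")
    case True
    with that show ?thesis by (intro exI[of _ "y2 / x2"]) simp
  next
    case False
    with that show ?thesis by (intro exI[of _ "y1 / x1"]) (simp add: field_simps)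
  qed
  show thesis
  proof (cases "p1 = 0 \<and> p2 = 0")
    case False
    then obtain b c where "s1 = b * p1 \<and> s2 = b * p2" "q1 = c * p1 \<and> q2 = c * p2"
      using key assms by metis
    with that[of 1 p1 p2 b c] show thesis by simp
  next
    case p: True
    show thesis
    proof (cases "s1 = 0 \<and> s2 = 0")
      case False
      then obtain c where "q1 = c * s1 \<and> q2 = c * s2" using key assms by metis
      with p that[of 0 s1 s2 1 c] show thesis by simp
    next
      case True
      with p that[of 0 q1 q2 0 1] show thesis by simp
    qed
  qed
qed

context lie_almost_complex
begin

lemma derived_abelian:
  assumes ab: "abelian_structure br J" and u: "u \<in> derived" and v: "v \<in> derived"
  shows "br u v = 0"
proof -
  have 1: "br (br x y) v = 0" for x y
  proof -
    have "derived \<subseteq> {v. br (br x y) v = 0}"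
      by (rule derived_subset)
        (auto simp: subspace_def br_simps metabelian_if_abelian_structure[OF ab])
    with v show ?thesis by blast
  qed
  have "derived \<subseteq> {u. br u v = 0}"
    by (rule derived_subset) (auto simp: subspace_def br_simps 1)
  with u show ?thesis by blast
qed

text \<open>For abelian \<open>J\<close> the remaining brackets of basis vectors are, up to sign, the four that are listed.\<close>

lemma bracket_on_frame_in_subspace:
  assumes ab: "abelian_structure br J" and F: "frame x (J x) w (J w)" and S: "subspace S"
    and in_S: "br x (J x) \<in> S" "br x w \<in> S" "br x (J w) \<in> S" "br w (J w) \<in> S"
  shows "br u v \<in> S"
proof -
  have JJ: "br (J a) (J b) = br a b" for a b using ab by (simp add: abelian_structure_def)
  note Jl = abelian_br_J_left[OF ab]
  obtain p q r s where u: "u = p *\<^sub>R x + q *\<^sub>R J x + r *\<^sub>R w + s *\<^sub>R J w"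
    using frameE[OF F] by blast
  obtain p' q' r' s' where v: "v = p' *\<^sub>R x + q' *\<^sub>R J x + r' *\<^sub>R w + s' *\<^sub>R J w"
    using frameE[OF F] by blast
  have swap: "br w x = - br x w" "br w (J x) = br x (J w)" "br (J w) x = - br x (J w)"
    "br (J x) w = - br x (J w)" "br (J x) x = - br x (J x)" "br (J w) w = - br w (J w)"
    "br (J w) (J x) = - br x w"
    using Jl[of x w] br_skew[of w "J x"] JJ[of w x] br_skew[of "J w" x] br_skew[of "J x" x]
      br_skew[of "J w" w] br_skew[of w x] by simp_all
  hence "br u v = (p * q' - q * p') *\<^sub>R br x (J x) + (r * s' - s * r') *\<^sub>R br w (J w)
      + (p * r' + q * s' - r * p' - s * q') *\<^sub>R br x w
      + (p * s' - q * r' + r * q' - s * p') *\<^sub>R br x (J w)"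
    by (simp add: u v br_simps br_self JJ swap algebra_simps)
  thus ?thesis using S in_S by (simp add: subspace_add subspace_scale)
qed

text \<open>A vector of the derived algebra outside the complex line of \<open>m\<close> would commute with \<open>m\<close> and \<open>J m\<close>, leaving
  only one independent bracket; so the derived algebra lies in this line. For \<open>w\<close> outside the line, the
  operators of \<open>w\<close> and \<open>J w\<close> on it commute since the derived algebra is abelian. The resulting equations add up to
  \<open>(a - d)\<^sup>2 + (b + c)\<^sup>2 = 0\<close>, which says that \<open>w\<close> acts as multiplication by the complex number \<open>a + i b\<close>. This
  number is not zero, again because there would be only one independent bracket, and dividing by it yields \<open>s\<close>.\<close>

lemma affine_frame_if_derived_contains_complex_line:
  assumes dim4: "dim (UNIV :: 'a set) = 4" and ab: "abelian_structure br J"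
    and no_line: "\<nexists>z. \<forall>u v. br u v \<in> span {z}"
    and m: "m \<in> derived" and Jm: "J m \<in> derived" and m0: "m \<noteq> 0"
  obtains s t x y where "affine_frame br s t x y"
proof -
  have JJ: "br (J u) (J v) = br u v" for u v using ab by (simp add: abelian_structure_def)
  note Jl = abelian_br_J_left[OF ab]
  have mJm: "br m (J m) = 0" by (rule derived_abelian[OF ab m Jm])
  have der: "derived \<subseteq> span {m, J m}"
  proof
    fix q assume q: "q \<in> derived"
    show "q \<in> span {m, J m}"
    proof (rule ccontr)
      assume "q \<notin> span {m, J m}"
      hence F: "frame m (J m) q (J q)" by (rule frame_of_complex_line_and_outside[OF dim4 m0])
      have 0: "br m q = 0" "br (J m) q = 0" using derived_abelian[OF ab] m Jm q by auto
      have "br u v \<in> span {br q (J q)}" for u v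
        by (rule bracket_on_frame_in_subspace[OF ab F])
          (use 0 Jl[of m q] mJm in \<open>simp_all add: span_base span_zero\<close>)
      with no_line show False by blast
    qed
  qed
  obtain w where w: "w \<notin> span {m, J m}" by (rule exists_outside_span_pair[OF dim4])
  have F: "frame m (J m) w (J w)" by (rule frame_of_complex_line_and_outside[OF dim4 m0 w])
  have ind: "p = 0" "q = 0" if "p *\<^sub>R m + q *\<^sub>R J m = 0" for p q
    using frame_coeff_zero(1,2)[OF F, of p q 0 0] that by simp_all
  have eqI: "p = p' \<and> q = q'" if "p *\<^sub>R m + q *\<^sub>R J m = p' *\<^sub>R m + q' *\<^sub>R J m" for p q p' q'
    using ind[of "p - p'" "q - q'"] that by (simp add: algebra_simps)
  obtain a b where wm: "br w m = a *\<^sub>R m + b *\<^sub>R J m"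
    using subsetD[OF der br_in_derived[of w m]] by (auto simp: span_pair_iff)
  obtain c d where wJm: "br w (J m) = c *\<^sub>R m + d *\<^sub>R J m"
    using subsetD[OF der br_in_derived[of w "J m"]] by (auto simp: span_pair_iff)
  have Jw: "br (J w) m = - (c *\<^sub>R m + d *\<^sub>R J m)" "br (J w) (J m) = a *\<^sub>R m + b *\<^sub>R J m"
    using Jl[of w m] by (simp_all add: JJ wm wJm)
  have com: "br w (br (J w) v) = br (J w) (br w v)" if "v \<in> derived" for v
    using leibniz[of w "J w" v] derived_abelian[OF ab br_in_derived that] by simp
  have "(- (c * a + d * c)) *\<^sub>R m + (- (c * b + d * d)) *\<^sub>R J m
      = (b * a - a * c) *\<^sub>R m + (b * b - a * d) *\<^sub>R J m"
    using com[OF m] by (simp add: Jw wm wJm br_simps algebra_simps)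
  note 1 = eqI[OF this]
  have "(a * a + b * c) *\<^sub>R m + (a * b + b * d) *\<^sub>R J m
      = (d * a - c * c) *\<^sub>R m + (d * b - c * d) *\<^sub>R J m"
    using com[OF Jm] by (simp add: Jw wm wJm br_simps algebra_simps)
  note 2 = eqI[OF this]
  \<comment> \<open>add the coefficient of \<open>J m\<close> in the first relation and that of \<open>m\<close> in the second\<close>
  have "(a - d) * (a - d) + (b + c) * (b + c) = 0"
    using 1 2 by (simp add: algebra_simps)
  hence dc: "d = a" "c = - b" by (auto simp: sum_squares_eq_zero_iff)
  define n where "n = a * a + b * b"
  have n0: "n \<noteq> 0"
  proof
    assume "n = 0"
    hence 0: "a = 0" "b = 0" by (auto simp: n_def sum_squares_eq_zero_iff)
    hence z: "br m w = 0" "br m (J w) = 0"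
      using wm wJm dc br_skew[of m w] Jl[of w m] br_skew[of m "J w"] by auto
    have "br u v \<in> span {br w (J w)}" for u v
      by (rule bracket_on_frame_in_subspace[OF ab F])
        (use z mJm in \<open>simp_all add: span_base span_zero\<close>)
    with no_line show False by blast
  qed
  define s where "s = inverse n *\<^sub>R (a *\<^sub>R w + b *\<^sub>R J w)"
  have "br s m = inverse n *\<^sub>R (n *\<^sub>R m)"
    by (simp add: s_def n_def br_simps Jw wm wJm dc algebra_simps)
  hence sm: "br s m = m" using n0 by simp
  have "br s (J m) = inverse n *\<^sub>R (n *\<^sub>R J m)"
    by (simp add: s_def n_def br_simps Jw wm wJm dc algebra_simps)
  hence sJm: "br s (J m) = J m" using n0 by simp
  have "br (- J s) m = J m" by (simp add: br_simps Jl sJm)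
  hence "affine_frame br s (- J s) m (J m)"
    unfolding affine_frame_def using der br_in_derived sm sJm mJm ind by blast
  thus thesis by (rule that)
qed

text \<open>Now the derived algebra \<open>V\<close> is a plane with \<open>V + J V\<close> everything, and \<open>u v = [J u, v]\<close> is a commutative
  associative multiplication on \<open>V\<close> whose products span \<open>V\<close>. It has a unit: multiplication by
  \<open>\<alpha> p + \<beta> q\<close> has a determinant quadratic in \<open>\<alpha>\<close> and \<open>\<beta>\<close>, whose coefficients are the pairwise
  determinants of the products \<open>p p\<close>, \<open>p q\<close>, \<open>q q\<close>. If it vanished identically, these products would lie on one line. So
  some \<open>a\<close> acts invertibly, and the solution \<open>e\<close> of \<open>a e = a\<close> is a unit, since \<open>a (e x) = (a e) x = a x\<close>. The frame is then \<open>J e, J f, e, f\<close>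
  for any \<open>f\<close> in \<open>V\<close> independent of \<open>e\<close>.\<close>

lemma affine_frame_if_derived_totally_real:
  assumes dim4: "dim (UNIV :: 'a set) = 4" and ab: "abelian_structure br J"
    and no_line: "\<nexists>z. \<forall>u v. br u v \<in> span {z}"
    and totally_real: "\<And>m. m \<in> derived \<Longrightarrow> J m \<in> derived \<Longrightarrow> m = 0"
  obtains s t x y where "affine_frame br s t x y"
proof -
  note conclude = that
  have JJ: "br (J u) (J v) = br u v" for u v using ab by (simp add: abelian_structure_def)
  note Jl = abelian_br_J_left[OF ab]
  have sub: "subspace derived" unfolding derived_def by (rule subspace_span)
  note in_der = subspace_add[OF sub] subspace_scale[OF sub] subspace_diff[OF sub]
  note D0 = derived_abelian[OF ab]
  have comm: "br (J u) v = br (J v) u" for u v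
    using Jl[of u v] br_skew[of u "J v"] by simp
  obtain p where p: "p \<in> derived" "p \<noteq> 0"
  proof -
    obtain u v where "br u v \<noteq> 0" using no_line span_zero by metis
    thus thesis using that br_in_derived by blast
  qed
  obtain q where q: "q \<in> derived" "q \<notin> span {p}"
    using no_line br_in_derived by blast
  have "q \<notin> span {p, J p}"
  proof
    assume "q \<in> span {p, J p}"
    then obtain a b where ab': "q = a *\<^sub>R p + b *\<^sub>R J p" by (auto simp: span_pair_iff)
    have "J (b *\<^sub>R p) = q - a *\<^sub>R p" by (simp add: ab' J_simps)
    hence "J (b *\<^sub>R p) \<in> derived" using p q in_der by simp
    hence "b *\<^sub>R p = 0" using totally_real p in_der by blast
    hence "q = a *\<^sub>R p" using p by (simp add: ab')
    with q(2) show False by (simp add: span_scale span_base)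
  qed
  hence F: "frame p (J p) q (J q)" by (rule frame_of_complex_line_and_outside[OF dim4 p(2)])
  have ind: "a = 0" "b = 0" if "a *\<^sub>R p + b *\<^sub>R q = 0" for a b
    using frame_coeff_zero(1,3)[OF F, of a 0 b 0] that by simp_all
  have der: "v \<in> span {p, q}" if v: "v \<in> derived" for v
  proof -
    obtain a b c d where e: "v = a *\<^sub>R p + b *\<^sub>R J p + c *\<^sub>R q + d *\<^sub>R J q"
      using frameE[OF F] by blast
    have "J (b *\<^sub>R p + d *\<^sub>R q) = v - a *\<^sub>R p - c *\<^sub>R q" by (simp add: e J_simps)
    hence "J (b *\<^sub>R p + d *\<^sub>R q) \<in> derived" using p q v in_der by simp
    hence "b *\<^sub>R p + d *\<^sub>R q = 0" using totally_real p q in_der by blast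
    from ind[OF this] show ?thesis by (auto simp: e span_pair_iff)
  qed
  obtain p1 p2 where P: "br (J p) p = p1 *\<^sub>R p + p2 *\<^sub>R q"
    using der[OF br_in_derived[of "J p" p]] by (auto simp: span_pair_iff)
  obtain s1 s2 where S: "br (J p) q = s1 *\<^sub>R p + s2 *\<^sub>R q"
    using der[OF br_in_derived[of "J p" q]] by (auto simp: span_pair_iff)
  obtain q1 q2 where Q: "br (J q) q = q1 *\<^sub>R p + q2 *\<^sub>R q"
    using der[OF br_in_derived[of "J q" q]] by (auto simp: span_pair_iff)
  have S': "br (J q) p = s1 *\<^sub>R p + s2 *\<^sub>R q" using S comm by simp
  define det where "det \<alpha> \<beta> = (\<alpha> * p1 + \<beta> * s1) * (\<alpha> * s2 + \<beta> * q2)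
      - (\<alpha> * p2 + \<beta> * s2) * (\<alpha> * s1 + \<beta> * q1)" for \<alpha> \<beta>
  have "\<exists>\<alpha> \<beta>. det \<alpha> \<beta> \<noteq> 0"
  proof (rule ccontr)
    assume "\<not> ?thesis"
    \<comment> \<open>\<open>det 1 1\<close> is the sum of all three pairwise determinants, so these values yield each of them\<close>
    hence "det 1 0 = 0" "det 0 1 = 0" "det 1 1 = 0" by blast+
    hence "p1 * s2 = p2 * s1" "s1 * q2 = s2 * q1" "p1 * q2 = p2 * q1"
      by (simp_all add: det_def algebra_simps)
    then obtain z1 z2 a b c where z: "p1 = a * z1" "p2 = a * z2" "s1 = b * z1" "s2 = b * z2"
      "q1 = c * z1" "q2 = c * z2" by (rule proportional_pairs)
    let ?z = "z1 *\<^sub>R p + z2 *\<^sub>R q"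
    have on_line: "br p (J p) = (- a) *\<^sub>R ?z" "br q (J q) = (- c) *\<^sub>R ?z" "br p (J q) = (- b) *\<^sub>R ?z"
      by (simp_all add: br_skew[of p "J p"] br_skew[of q "J q"] br_skew[of p "J q"] P Q S' z
          algebra_simps)
    have pq0: "br p q = 0" using D0 p q by blast
    have "br u v \<in> span {?z}" for u v
      by (rule bracket_on_frame_in_subspace[OF ab F])
        (simp_all only: on_line pq0 span_zero span_scale[OF span_base[OF insertI1]] subspace_span)
    with no_line show False by blast
  qed
  then obtain \<alpha> \<beta> where det0: "det \<alpha> \<beta> \<noteq> 0" by blast
  define a where "a = \<alpha> *\<^sub>R p + \<beta> *\<^sub>R q"
  have a_in: "a \<in> derived" using p q in_der by (simp add: a_def)
  have La: "br (J a) (x1 *\<^sub>R p + x2 *\<^sub>R q)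
      = (x1 * (\<alpha> * p1 + \<beta> * s1) + x2 * (\<alpha> * s1 + \<beta> * q1)) *\<^sub>R p
        + (x1 * (\<alpha> * p2 + \<beta> * s2) + x2 * (\<alpha> * s2 + \<beta> * q2)) *\<^sub>R q" for x1 x2
    by (simp add: a_def J_simps br_simps P Q S S' algebra_simps)
  have inj: "x = 0" if x: "x \<in> derived" and 0: "br (J a) x = 0" for x
  proof -
    obtain x1 x2 where xe: "x = x1 *\<^sub>R p + x2 *\<^sub>R q" using der[OF x] by (auto simp: span_pair_iff)
    have e1: "x1 * (\<alpha> * p1 + \<beta> * s1) + x2 * (\<alpha> * s1 + \<beta> * q1) = 0"
      and e2: "x1 * (\<alpha> * p2 + \<beta> * s2) + x2 * (\<alpha> * s2 + \<beta> * q2) = 0"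
      using ind 0 unfolding xe La by blast+
    have "x1 * det \<alpha> \<beta> = 0" "x2 * det \<alpha> \<beta> = 0"
      using e1 e2 unfolding det_def by algebra+
    with det0 show "x = 0" by (simp add: xe)
  qed
  \<comment> \<open>Cramer's rule for \<open>[J a, e] = a\<close>\<close>
  define e1 e2 where "e1 = (\<alpha> * (\<alpha> * s2 + \<beta> * q2) - \<beta> * (\<alpha> * s1 + \<beta> * q1)) / det \<alpha> \<beta>"
    and "e2 = (\<beta> * (\<alpha> * p1 + \<beta> * s1) - \<alpha> * (\<alpha> * p2 + \<beta> * s2)) / det \<alpha> \<beta>"
  define e where "e = e1 *\<^sub>R p + e2 *\<^sub>R q"
  have e_in: "e \<in> derived" using p q in_der by (simp add: e_def)
  have Le: "br (J a) e = a"
  proof -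
    have "e1 * det \<alpha> \<beta> = \<alpha> * (\<alpha> * s2 + \<beta> * q2) - \<beta> * (\<alpha> * s1 + \<beta> * q1)"
      "e2 * det \<alpha> \<beta> = \<beta> * (\<alpha> * p1 + \<beta> * s1) - \<alpha> * (\<alpha> * p2 + \<beta> * s2)"
      using det0 by (simp_all add: e1_def e2_def)
    hence "(e1 * (\<alpha> * p1 + \<beta> * s1) + e2 * (\<alpha> * s1 + \<beta> * q1)) * det \<alpha> \<beta> = \<alpha> * det \<alpha> \<beta>"
      "(e1 * (\<alpha> * p2 + \<beta> * s2) + e2 * (\<alpha> * s2 + \<beta> * q2)) * det \<alpha> \<beta> = \<beta> * det \<alpha> \<beta>"
      unfolding det_def by algebra+
    with det0 show ?thesis unfolding e_def La by (simp add: a_def)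
  qed
  have unit: "br (J e) x = x" if x: "x \<in> derived" for x
  proof -
    have "br (J a) (br (J e) x) = br (J a) (br (J x) e)" by (simp add: comm[of e x])
    also have "\<dots> = br (J x) (br (J a) e)"
      by (rule br_commuting) (simp add: JJ D0 a_in x)
    also have "\<dots> = br (J a) x" by (simp add: Le comm[of x a])
    finally have "br (J a) (br (J e) x - x) = 0" by (simp add: br_simps)
    moreover have "br (J e) x - x \<in> derived" using br_in_derived x in_der by blast
    ultimately show ?thesis using inj by fastforce
  qed
  have result: thesis
    if f: "f \<in> derived" and indf: "\<And>k l. k *\<^sub>R e + l *\<^sub>R f = 0 \<Longrightarrow> k = 0 \<and> l = 0"
      and pq: "p \<in> span {e, f}" "q \<in> span {e, f}" for f
  proof (rule conclude)
    have "span {p, q} \<subseteq> span {e, f}" using pq by (intro span_minimal) auto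
    hence "br u v \<in> span {e, f}" for u v using der[OF br_in_derived] by blast
    thus "affine_frame br (J e) (J f) e f"
      unfolding affine_frame_def
      using indf unit[OF e_in] unit[OF f] comm[of f e] D0[OF e_in f] by simp
  qed
  show thesis
  proof (cases "e2 = 0")
    case False
    have "q = inverse e2 *\<^sub>R e + (- e1 / e2) *\<^sub>R p"
      using False by (simp add: e_def algebra_simps divide_inverse)
    hence "q \<in> span {e, p}" by (metis span_pair_iff)
    moreover have "k = 0 \<and> l = 0" if "k *\<^sub>R e + l *\<^sub>R p = 0" for k l
      using ind[of "k * e1 + l" "k * e2"] that False by (simp add: e_def algebra_simps)
    ultimately show thesis using result[OF p(1)] by (simp add: span_base)
  next
    case True
    have e10: "e1 \<noteq> 0"
    proof
      assume "e1 = 0"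
      hence "br (J e) p = 0" using True by (simp add: e_def J_simps br_simps)
      with unit[OF p(1)] p(2) show False by simp
    qed
    have "p = inverse e1 *\<^sub>R e + 0 *\<^sub>R q" using True e10 by (simp add: e_def)
    hence "p \<in> span {e, q}" by (metis span_pair_iff)
    moreover have "k = 0 \<and> l = 0" if "k *\<^sub>R e + l *\<^sub>R q = 0" for k l
      using ind[of "k * e1" l] that True e10 by (simp add: e_def algebra_simps)
    ultimately show thesis using result[OF q(1)] by (simp add: span_base)
  qed
qed

text \<open>In the first alternative \<open>z\<close> may be taken nonzero even for an abelian algebra, where any nonzero vector serves.\<close>

lemma derived_line_or_affine_frame:
  assumes dim4: "dim (UNIV :: 'a set) = 4" and ab: "abelian_structure br J"
  obtains (line) z where "z \<noteq> 0" "\<And>u v. \<exists>c. br u v = c *\<^sub>R z"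
    | (affine) s t x y where "affine_frame br s t x y"
proof (cases "\<exists>z. \<forall>u v. br u v \<in> span {z}")
  case True
  then obtain z where z: "\<And>u v. br u v \<in> span {z}" by blast
  obtain z' :: 'a where z': "z' \<noteq> 0" "\<And>v. v \<in> span {z} \<Longrightarrow> v \<in> span {z'}"
  proof (cases "z = 0")
    case False
    with that[of z] show thesis by blast
  next
    case True
    obtain w :: 'a where "w \<notin> span {0, 0}" by (rule exists_outside_span_pair[OF dim4])
    hence "w \<noteq> 0" using span_zero by metis
    with that[of w] True show thesis by (simp add: span_zero)
  qed
  show thesis
  proof (rule line[OF z'(1)])
    fix u v
    have "br u v \<in> span {z'}" using z z' by blast
    thus "\<exists>c. br u v = c *\<^sub>R z'" by (auto simp: span_singleton)
  qed
next
  case False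
  show thesis
  proof (cases "\<exists>m. m \<in> derived \<and> J m \<in> derived \<and> m \<noteq> 0")
    case True
    with affine_frame_if_derived_contains_complex_line[OF dim4 ab False] affine show thesis
      by metis
  next
    case nex: False
    with affine_frame_if_derived_totally_real[OF dim4 ab False] affine show thesis
      by metis
  qed
qed

end

theorem corollary3p11:
  fixes br :: "'a::real_vector \<Rightarrow> 'a \<Rightarrow> 'a" and J :: "'a \<Rightarrow> 'a"
  assumes "lie_bracket br"
    and "dim (UNIV :: 'a set) = 4"
    and "\<exists>J'. complex_structure br J' \<and> abelian_structure br J'"
    and "complex_structure br J"
  shows "kaehler br J \<longleftrightarrow> symplectic br \<and> abelian_structure br J"
proof -
  note dim4 = assms(2)
  obtain J' where J': "complex_structure br J'" "abelian_structure br J'" using assms(3) by blast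
  have almost_complex: "lie_almost_complex br K" if "complex_structure br K" for K
    using assms(1) that
    by (simp add: lie_almost_complex_def lie_algebra_def almost_complex_def complex_structure_def)
  interpret lie_almost_complex br J by (rule almost_complex[OF assms(4)])
  interpret J': lie_almost_complex br J' by (rule almost_complex[OF J'(1)])
  have "kaehler br J \<longleftrightarrow> abelian_structure br J"
  proof (cases rule: J'.derived_line_or_affine_frame[OF dim4 J'(2)])
    case (1 z)
    from abelian_structure_if_derived_line[OF assms(4) 1(2)]
      kaehler_if_derived_line[OF dim4 _ 1(2,1)] show ?thesis by blast
  next
    case (2 s t x y)
    from abelian_structure_if_kaehler_affine[OF dim4 assms(4) 2]
      kaehler_if_affine[OF dim4 _ 2] show ?thesis by blast
  qed
  moreover have "kaehler br J \<Longrightarrow> symplectic br"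
    unfolding kaehler_def symplectic_def by blast
  ultimately show ?thesis by blast
qed

end
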